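(* The functor $\mathrm{Gl}$ preserves the 2-crossed module structure: if $K\xrightarrow{\partial_2}I\xrightarrow{\partial_1}H$ is a 2-crossed module of cocommutative Hopf algebras over $\kappa$, with actions $\vartriangleright_\rho$ and Peiffer lifting $\{\ ,\ \}$, then $\mathrm{Gl}(K)\xrightarrow{\partial_2}\mathrm{Gl}(I)\xrightarrow{\partial_1}\mathrm{Gl}(H)$, with the restricted maps, actions and Peiffer lifting, is a 2-crossed module of groups.
   Context: All Hopf algebras are cocommutative over an arbitrary field $\kappa$, with coproduct $\delta(x)=\sum_{(x)}x'\otimes x''$ (iterated: $x',x'',x''',\dots$), counit $\epsilon$, antipode $S$. The zero morphism $A\to B$ is $x\mapsto\epsilon(x)1_B$. Adjoint action: $x\vartriangleright_{ad}y=\sum_{(x)}x'\,y\,S(x'')$. $\mathrm{Gl}(H)=\{x\in H:\delta(x)=x\otimes x,\ \epsilon(x)=1\}$ is a group under the product of $H$, with $x^{-1}=S(x)$. An $H$-module bialgebra $I$ is a bialgebra with an $H$-module structure $\vartriangleright_\rho\colon H\otimes I\to I$ such that $x\vartriangleright_\rho 1=\epsilon(x)1$, $x\vartriangleright_\rho(uv)=\sum(x'\vartriangleright_\rho u)(x''\vartriangleright_\rho v)$, $\delta(x\vartriangleright_\rho v)=\sum(x'\vartriangleright_\rho v')\otimes(x''\vartriangleright_\rho v'')$, $\epsilon(x\vartriangleright_\rho v)=\epsilon(x)\epsilon(v)$. A crossed module of Hopf algebras is a Hopf algebra map $\partial\colon I\to H$ with an $H$-module bialgebra structure on $I$ such that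 $\partial(x\vartriangleright_\rho v)=x\vartriangleright_{ad}\partial(v)$ and $\partial(u)\vartriangleright_\rho v=u\vartriangleright_{ad}v$ for $x\in H$, $u,v\in I$. A 2-crossed module of Hopf algebras is a chain complex $K\xrightarrow{\partial_2}I\xrightarrow{\partial_1}H$ of Hopf algebras ($\partial_1\partial_2$ is the zero morphism) with actions $\vartriangleright_\rho$ of $H$ on $I$ and $K$, and on itself by the adjoint action, together with a bilinear map (Peiffer lifting) $\{\ ,\ \}$ from pairs of elements of $I$ to $K$ which is $H$-equivariant, i.e. $a\vartriangleright_\rho\{x,y\}=\sum_{(a)}\{a'\vartriangleright_\rho x,a''\vartriangleright_\rho y\}$, such that for all $x,y,z\in I$, $k,l\in K$: 1) it is a complex of $H$-module bialgebras: $\partial_2(a\vartriangleright_\rho k)=a\vartriangleright_\rho\partial_2(k)$ and $\partial_1(a\vartriangleright_\rho x)=a\vartriangleright_{ad}\partial_1(x)$ for $a\in H$; 2) $\partial_2\{x,y\}=\sum_{(x)(y)}(x'\vartriangleright_{ad}y')\,\big(\partial_1(x'')\vartriangleright_\rho S(y'')\big)$; 3) $\{\partial_2(k),\partial_2(l)\}=\sum_{(l)}(k\vartriangleright_{ad}l')\,S(l'')$; 4) $\{x,yz\}=\sum_{(x)(y)}\{x',y'\}\,\big((\partial_1(x'')\vartriangleright_\rho y'')\vartriangleright'_\rho\{x''',z\}\big)$; 5) $\{xy,z\}=\sum_{(x)(y)(z)}\{x',y'\vartriangleright_{ad}z'\}\,\big(\partial_1(x'')\vartriangleright_\rho\{y'',z''\}\big)$;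 6) $\sum_{(k)(x)}\{\partial_2(k'),x'\}\{x'',\partial_2(k'')\}=\sum_{(k)}k'\,\big(\partial_1(x)\vartriangleright_\rho S(k'')\big)$; where in 4) the action of $I$ on $K$ is $x\vartriangleright'_\rho k=\sum_{(k)}k'\,\{\partial_2(S(k'')),x\}$, such that $(\partial_2\colon K\to I,\vartriangleright'_\rho)$ becomes a crossed module. A crossed module of groups is a group homomorphism $\partial\colon E\to G$ with an action $\triangleright$ of $G$ on $E$ by automorphisms such that $\partial(g\triangleright e)=g\,\partial(e)\,g^{-1}$ and $\partial(e)\triangleright f=efe^{-1}$. A 2-crossed module of groups is a chain complex of groups $L\xrightarrow{\partial_2}E\xrightarrow{\partial_1}G$ with left actions $\triangleright$ of $G$ on $E,L$ and a $G$-equivariant function (Peiffer lifting) $\{\ ,\ \}$ from pairs of elements of $E$ to $L$ ($g\triangleright\{e,f\}=\{g\triangleright e,g\triangleright f\}$), such that for all $l,m\in L$, $e,f,g\in E$: 1) it is a complex of $G$-modules, where $G$ acts on itself by conjugation; 2) $\partial_2\{e,f\}=(efe^{-1})\,(\partial_1(e)\triangleright f^{-1})$; 3) $\{\partial_2(l),\partial_2(m)\}=lml^{-1}m^{-1}$; 4) $\{e,fg\}=\{e,f\}\,\big((\partial_1(e)\triangleright f)\triangleright'\{e,g\}\big)$; 5) $\{ef,g\}=\{e,fgf^{-1}\}\,\big(\partial_1(e)\triangleright\{f,g\}\big)$; 6) $\{\partial_2(l),e\}\,\{e,\partial_2(l)\}=l\,(\partial_1(e)\triangleright l^{-1})$;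 where $e\triangleright'l=l\,\{\partial_2(l^{-1}),e\}$, which turns $(\partial_2\colon L\to E,\triangleright')$ into a crossed module.
   Formalization: The Peiffer lifting is assumed to be a morphism of coalgebras from I⊗I to K (compatible with coproduct and counit), not merely a bilinear map; with bilinearity alone it need not send group-like elements to group-like elements. *)

theory Defs
  imports Complex_Main "HOL-Algebra.Group"
begin

section \<open>Tensors as formal sums\<close>

text \<open>
  A tensor \<open>\<Sum>\<^sub>i a\<^sub>i \<otimes> b\<^sub>i\<close> is represented by the list of the pairs \<open>(a\<^sub>i, b\<^sub>i)\<close>, and equality in
  \<open>A \<otimes> A\<close> by a congruence on such lists: the tensor product is the free commutative monoid on
  \<open>A \<times> A\<close> modulo the congruence generated by bi-additivity, \<open>0 \<otimes> b = 0\<close> and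
  \<open>ra \<otimes> b = a \<otimes> rb\<close>. The rule for zero is needed because cancellation is not available in the
  free commutative monoid; with it the quotient is an abelian group, with \<open>- (a \<otimes> b) = (- a) \<otimes> b\<close>
  (and \<open>a \<otimes> 0 = 0a \<otimes> 0 = 0\<close> by moving the scalar).
  With this representation the Sweedler sum \<open>\<Sum>\<^sub>(\<^sub>x\<^sub>) f(x', x'')\<close> is literally a sum over the list
  chosen for \<open>\<delta>(x)\<close>; for bilinear \<open>f\<close> it depends only on the tensor.
\<close>

inductive fsum_eq :: "('p list \<Rightarrow> 'p list \<Rightarrow> bool) \<Rightarrow> 'p list \<Rightarrow> 'p list \<Rightarrow> bool"
  for R where
  fsum_rel: "R xs ys \<Longrightarrow> fsum_eq R xs ys"
| fsum_refl: "fsum_eq R xs xs"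
| fsum_sym: "fsum_eq R xs ys \<Longrightarrow> fsum_eq R ys xs"
| fsum_trans: "fsum_eq R xs ys \<Longrightarrow> fsum_eq R ys zs \<Longrightarrow> fsum_eq R xs zs"
| fsum_comm: "fsum_eq R (xs @ ys) (ys @ xs)"
| fsum_append: "fsum_eq R xs ys \<Longrightarrow> fsum_eq R xs' ys' \<Longrightarrow> fsum_eq R (xs @ xs') (ys @ ys')"

inductive tensor2_rel ::
  "('k \<Rightarrow> 'a \<Rightarrow> 'a) \<Rightarrow> ('a \<times> 'a) list \<Rightarrow> ('a::ab_group_add \<times> 'a) list \<Rightarrow> bool"
  for s where
  t2_zero: "tensor2_rel s [(0, b)] []"
| t2_add1: "tensor2_rel s [(a + a', b)] [(a, b), (a', b)]"
| t2_add2: "tensor2_rel s [(a, b + b')] [(a, b), (a, b')]"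
| t2_scale: "tensor2_rel s [(s r a, b)] [(a, s r b)]"

inductive tensor3_rel ::
  "('k \<Rightarrow> 'a \<Rightarrow> 'a) \<Rightarrow> ('a \<times> 'a \<times> 'a) list \<Rightarrow> ('a::ab_group_add \<times> 'a \<times> 'a) list \<Rightarrow> bool"
  for s where
  t3_zero: "tensor3_rel s [(0, b, c)] []"
| t3_add1: "tensor3_rel s [(a + a', b, c)] [(a, b, c), (a', b, c)]"
| t3_add2: "tensor3_rel s [(a, b + b', c)] [(a, b, c), (a, b', c)]"
| t3_add3: "tensor3_rel s [(a, b, c + c')] [(a, b, c), (a, b, c')]"
| t3_scale12: "tensor3_rel s [(s r a, b, c)] [(a, s r b, c)]"
| t3_scale23: "tensor3_rel s [(a, s r b, c)] [(a, b, s r c)]"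

abbreviation tensor2_eq where "tensor2_eq s \<equiv> fsum_eq (tensor2_rel s)"
abbreviation tensor3_eq where "tensor3_eq s \<equiv> fsum_eq (tensor3_rel s)"


section \<open>Cocommutative Hopf algebras\<close>

text \<open>
  The underlying ring is the type \<open>'a\<close>. That \<open>'a\<close> satisfies \<open>0 \<noteq> 1\<close> is no restriction, since
  \<open>\<epsilon>(1) = 1\<close> in the ground field.
\<close>

record ('k, 'a) hopf =
  smul :: "'k \<Rightarrow> 'a \<Rightarrow> 'a"
  comult :: "'a \<Rightarrow> ('a \<times> 'a) list"
  counit :: "'a \<Rightarrow> 'k"
  antipode :: "'a \<Rightarrow> 'a"

locale bialgebra =
  fixes A :: "('k::field, 'a::ring_1) hopf"
  assumes vector_space: "vector_space (smul A)"
    and smul_mult_left: "smul A r (x * y) = smul A r x * y"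
    and smul_mult_right: "smul A r (x * y) = x * smul A r y"
    and comult_add: "tensor2_eq (smul A) (comult A (x + y)) (comult A x @ comult A y)"
    and comult_smul: "tensor2_eq (smul A) (comult A (smul A r x))
           [(smul A r x1, x2). (x1, x2) \<leftarrow> comult A x]"
    and counit_linear: "Vector_Spaces.linear (smul A) (*) (counit A)"
    and coassoc: "tensor3_eq (smul A)
           [(y1, y2, x2). (x1, x2) \<leftarrow> comult A x, (y1, y2) \<leftarrow> comult A x1]
           [(x1, y1, y2). (x1, x2) \<leftarrow> comult A x, (y1, y2) \<leftarrow> comult A x2]"
    and counit_left: "(\<Sum>(x1, x2)\<leftarrow>comult A x. smul A (counit A x1) x2) = x"
    and counit_right: "(\<Sum>(x1, x2)\<leftarrow>comult A x. smul A (counit A x2) x1) = x"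
    and comult_one: "tensor2_eq (smul A) (comult A 1) [(1, 1)]"
    and comult_mult: "tensor2_eq (smul A) (comult A (x * y))
           [(x1 * y1, x2 * y2). (x1, x2) \<leftarrow> comult A x, (y1, y2) \<leftarrow> comult A y]"
    and counit_one: "counit A 1 = 1"
    and counit_mult: "counit A (x * y) = counit A x * counit A y"

locale cocomm_hopf_algebra = bialgebra A
  for A :: "('k::field, 'a::ring_1) hopf" +
  assumes antipode_linear: "Vector_Spaces.linear (smul A) (smul A) (antipode A)"
    and antipode_left:
      "(\<Sum>(x1, x2)\<leftarrow>comult A x. antipode A x1 * x2) = smul A (counit A x) 1"
    and antipode_right:
      "(\<Sum>(x1, x2)\<leftarrow>comult A x. x1 * antipode A x2) = smul A (counit A x) 1"
    and cocomm: "tensor2_eq (smul A) [(x2, x1). (x1, x2) \<leftarrow> comult A x] (comult A x)"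

definition adj :: "('k, 'a::ring_1) hopf \<Rightarrow> 'a \<Rightarrow> 'a \<Rightarrow> 'a" where
  "adj A x y = (\<Sum>(x1, x2)\<leftarrow>comult A x. x1 * y * antipode A x2)"

definition Gl :: "('k::one, 'a::ring_1) hopf \<Rightarrow> 'a monoid" where
  "Gl A = \<lparr>carrier = {x. tensor2_eq (smul A) (comult A x) [(x, x)] \<and> counit A x = 1},
           monoid.mult = (*), one = 1\<rparr>"

locale hopf_hom =
  fixes A :: "('k::field, 'a::ring_1) hopf"
    and B :: "('k, 'b::ring_1) hopf"
    and f :: "'a \<Rightarrow> 'b"
  assumes hom_linear: "Vector_Spaces.linear (smul A) (smul B) f"
    and hom_one: "f 1 = 1"
    and hom_mult: "f (x * y) = f x * f y"
    and hom_comult: "tensor2_eq (smul B) (comult B (f x))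
           [(f x1, f x2). (x1, x2) \<leftarrow> comult A x]"
    and hom_counit: "counit B (f x) = counit A x"

definition bilinear_over ::
  "('k::field \<Rightarrow> 'a \<Rightarrow> 'a) \<Rightarrow> ('k \<Rightarrow> 'b \<Rightarrow> 'b) \<Rightarrow> ('k \<Rightarrow> 'c \<Rightarrow> 'c) \<Rightarrow>
    ('a::ab_group_add \<Rightarrow> 'b::ab_group_add \<Rightarrow> 'c::ab_group_add) \<Rightarrow> bool"
  where
  "bilinear_over s1 s2 s3 f \<longleftrightarrow>
     (\<forall>x. Vector_Spaces.linear s2 s3 (\<lambda>y. f x y)) \<and>
     (\<forall>y. Vector_Spaces.linear s1 s3 (\<lambda>x. f x y))"

locale module_bialgebra =
  H: bialgebra H + I: bialgebra I
  for H :: "('k::field, 'h::ring_1) hopf"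
    and I :: "('k, 'i::ring_1) hopf" +
  fixes act :: "'h \<Rightarrow> 'i \<Rightarrow> 'i"
  assumes act_bilinear: "bilinear_over (smul H) (smul I) (smul I) act"
    and one_act: "act 1 v = v"
    and mult_act: "act (x * y) v = act x (act y v)"
    and act_one: "act x 1 = smul I (counit H x) 1"
    and act_mult: "act x (u * v) = (\<Sum>(x1, x2)\<leftarrow>comult H x. act x1 u * act x2 v)"
    and act_comult: "tensor2_eq (smul I) (comult I (act x v))
           [(act x1 v1, act x2 v2). (x1, x2) \<leftarrow> comult H x, (v1, v2) \<leftarrow> comult I v]"
    and act_counit: "counit I (act x v) = counit H x * counit I v"

locale hopf_crossed_module =
  I: cocomm_hopf_algebra I + H: cocomm_hopf_algebra H +
  hopf_hom I H bd + module_bialgebra H I act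
  for I :: "('k::field, 'i::ring_1) hopf"
    and H :: "('k, 'h::ring_1) hopf"
    and bd :: "'i \<Rightarrow> 'h"
    and act :: "'h \<Rightarrow> 'i \<Rightarrow> 'i" +
  assumes bd_act: "bd (act x v) = adj H x (bd v)"
    and peiffer: "act (bd u) v = adj I u v"

definition peiffer_act ::
  "('k, 'c::ring_1) hopf \<Rightarrow> ('c \<Rightarrow> 'i) \<Rightarrow> ('i \<Rightarrow> 'i \<Rightarrow> 'c) \<Rightarrow> 'i \<Rightarrow> 'c \<Rightarrow> 'c" where
  "peiffer_act K bd2 P x k = (\<Sum>(k1, k2)\<leftarrow>comult K k. k1 * P (bd2 (antipode K k2)) x)"

text \<open>
  As the actions are, the Peiffer lifting is a morphism of coalgebras
  \<open>I \<otimes> I \<rightarrow> K\<close>, not merely a bilinear map. The other axioms do not imply this: let \<open>H = \<kappa> = \<rat>\<close>,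
  \<open>I = \<rat>[\<int>]\<close>, \<open>K = \<rat>[\<int>/2]\<close> with generators \<open>g\<close> and \<open>h\<close>, zero morphisms and trivial actions, and
  \<open>{g\<^sup>m, g\<^sup>n} = u\<^sup>m\<^sup>n\<close> for the unit \<open>u = 2 - h\<close>. They all hold there, but \<open>{g, g} = u\<close> is not group-like.

  Iterated coproducts are expanded to the right: \<open>x', x'', x'''\<close> are \<open>x1, x2, x3\<close> with
  \<open>(x1, r)\<close> from the coproduct of \<open>x\<close> and \<open>(x2, x3)\<close> from that of \<open>r\<close>.
\<close>

locale hopf_2_crossed_module =
  K: cocomm_hopf_algebra K + I: cocomm_hopf_algebra I + H: cocomm_hopf_algebra H +
  bd2: hopf_hom K I bd2 + bd1: hopf_hom I H bd1 +
  actI: module_bialgebra H I actI + actK: module_bialgebra H K actK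
  for K :: "('k::field, 'c::ring_1) hopf"
    and I :: "('k, 'i::ring_1) hopf"
    and H :: "('k, 'h::ring_1) hopf"
    and bd2 :: "'c \<Rightarrow> 'i"
    and bd1 :: "'i \<Rightarrow> 'h"
    and actI :: "'h \<Rightarrow> 'i \<Rightarrow> 'i"
    and actK :: "'h \<Rightarrow> 'c \<Rightarrow> 'c" +
  fixes P :: "'i \<Rightarrow> 'i \<Rightarrow> 'c"
  assumes complex: "bd1 (bd2 k) = smul H (counit K k) 1"
    and P_bilinear: "bilinear_over (smul I) (smul I) (smul K) P"
    and P_comult: "tensor2_eq (smul K) (comult K (P x y))
           [(P x1 y1, P x2 y2). (x1, x2) \<leftarrow> comult I x, (y1, y2) \<leftarrow> comult I y]"
    and P_counit: "counit K (P x y) = counit I x * counit I y"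
    and P_equivariant:
      "actK a (P x y) = (\<Sum>(a1, a2)\<leftarrow>comult H a. P (actI a1 x) (actI a2 y))"
    and bd2_act: "bd2 (actK a k) = actI a (bd2 k)"
    and bd1_act: "bd1 (actI a x) = adj H a (bd1 x)"
    and bd2_P: "bd2 (P x y) =
          (\<Sum>(x1, x2)\<leftarrow>comult I x. \<Sum>(y1, y2)\<leftarrow>comult I y.
             adj I x1 y1 * actI (bd1 x2) (antipode I y2))"
    and P_bd2_bd2: "P (bd2 k) (bd2 l) = (\<Sum>(l1, l2)\<leftarrow>comult K l. adj K k l1 * antipode K l2)"
    and P_mult_right: "P x (y * z) =
          (\<Sum>(x1, r)\<leftarrow>comult I x. \<Sum>(x2, x3)\<leftarrow>comult I r. \<Sum>(y1, y2)\<leftarrow>comult I y.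
             P x1 y1 * peiffer_act K bd2 P (actI (bd1 x2) y2) (P x3 z))"
    and P_mult_left: "P (x * y) z =
          (\<Sum>(x1, x2)\<leftarrow>comult I x. \<Sum>(y1, y2)\<leftarrow>comult I y. \<Sum>(z1, z2)\<leftarrow>comult I z.
             P x1 (adj I y1 z1) * actK (bd1 x2) (P y2 z2))"
    and P_bd2_left_right:
      "(\<Sum>(k1, k2)\<leftarrow>comult K k. \<Sum>(x1, x2)\<leftarrow>comult I x. P (bd2 k1) x1 * P x2 (bd2 k2)) =
       (\<Sum>(k1, k2)\<leftarrow>comult K k. k1 * actK (bd1 x) (antipode K k2))"
    and peiffer_crossed: "hopf_crossed_module K I bd2 (peiffer_act K bd2 P)"


section \<open>2-crossed modules of groups\<close>

locale group_act_autos = G: group G + E: group E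
  for G :: "('g, 'm) monoid_scheme" (structure)
    and E :: "('e, 'n) monoid_scheme" (structure) +
  fixes act :: "'g \<Rightarrow> 'e \<Rightarrow> 'e"
  assumes act_iso: "g \<in> carrier G \<Longrightarrow> act g \<in> iso E E"
    and one_act: "e \<in> carrier E \<Longrightarrow> act \<one>\<^bsub>G\<^esub> e = e"
    and mult_act: "\<lbrakk>g \<in> carrier G; h \<in> carrier G; e \<in> carrier E\<rbrakk> \<Longrightarrow>
           act (g \<otimes>\<^bsub>G\<^esub> h) e = act g (act h e)"

locale group_crossed_module = group_act_autos G E act
  for E :: "('e, 'n) monoid_scheme" (structure)
    and G :: "('g, 'm) monoid_scheme" (structure)
    and bd :: "'e \<Rightarrow> 'g"
    and act :: "'g \<Rightarrow> 'e \<Rightarrow> 'e" +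
  assumes bd_hom: "bd \<in> hom E G"
    and bd_act: "\<lbrakk>g \<in> carrier G; e \<in> carrier E\<rbrakk> \<Longrightarrow>
           bd (act g e) = g \<otimes>\<^bsub>G\<^esub> bd e \<otimes>\<^bsub>G\<^esub> inv\<^bsub>G\<^esub> g"
    and peiffer: "\<lbrakk>e \<in> carrier E; f \<in> carrier E\<rbrakk> \<Longrightarrow>
           act (bd e) f = e \<otimes>\<^bsub>E\<^esub> f \<otimes>\<^bsub>E\<^esub> inv\<^bsub>E\<^esub> e"

definition group_peiffer_act ::
  "('l, 'm) monoid_scheme \<Rightarrow> ('l \<Rightarrow> 'e) \<Rightarrow> ('e \<Rightarrow> 'e \<Rightarrow> 'l) \<Rightarrow> 'e \<Rightarrow> 'l \<Rightarrow> 'l" where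
  "group_peiffer_act L bd2 P e l = l \<otimes>\<^bsub>L\<^esub> P (bd2 (inv\<^bsub>L\<^esub> l)) e"

locale group_2_crossed_module =
  actE: group_act_autos G E actE + actL: group_act_autos G L actL
  for L :: "('l, 'o) monoid_scheme" (structure)
    and E :: "('e, 'n) monoid_scheme" (structure)
    and G :: "('g, 'm) monoid_scheme" (structure)
    and bd2 :: "'l \<Rightarrow> 'e"
    and bd1 :: "'e \<Rightarrow> 'g"
    and actE :: "'g \<Rightarrow> 'e \<Rightarrow> 'e"
    and actL :: "'g \<Rightarrow> 'l \<Rightarrow> 'l" +
  fixes P :: "'e \<Rightarrow> 'e \<Rightarrow> 'l"
  assumes bd2_hom: "bd2 \<in> hom L E"
    and bd1_hom: "bd1 \<in> hom E G"
    and complex: "l \<in> carrier L \<Longrightarrow> bd1 (bd2 l) = \<one>\<^bsub>G\<^esub>"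
    and P_closed: "\<lbrakk>e \<in> carrier E; f \<in> carrier E\<rbrakk> \<Longrightarrow> P e f \<in> carrier L"
    and P_equivariant: "\<lbrakk>g \<in> carrier G; e \<in> carrier E; f \<in> carrier E\<rbrakk> \<Longrightarrow>
           actL g (P e f) = P (actE g e) (actE g f)"
    and bd2_act: "\<lbrakk>g \<in> carrier G; l \<in> carrier L\<rbrakk> \<Longrightarrow> bd2 (actL g l) = actE g (bd2 l)"
    and bd1_act: "\<lbrakk>g \<in> carrier G; e \<in> carrier E\<rbrakk> \<Longrightarrow>
           bd1 (actE g e) = g \<otimes>\<^bsub>G\<^esub> bd1 e \<otimes>\<^bsub>G\<^esub> inv\<^bsub>G\<^esub> g"
    and bd2_P: "\<lbrakk>e \<in> carrier E; f \<in> carrier E\<rbrakk> \<Longrightarrow>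
           bd2 (P e f) =
             (e \<otimes>\<^bsub>E\<^esub> f \<otimes>\<^bsub>E\<^esub> inv\<^bsub>E\<^esub> e) \<otimes>\<^bsub>E\<^esub> actE (bd1 e) (inv\<^bsub>E\<^esub> f)"
    and P_bd2_bd2: "\<lbrakk>l \<in> carrier L; m \<in> carrier L\<rbrakk> \<Longrightarrow>
           P (bd2 l) (bd2 m) = l \<otimes>\<^bsub>L\<^esub> m \<otimes>\<^bsub>L\<^esub> inv\<^bsub>L\<^esub> l \<otimes>\<^bsub>L\<^esub> inv\<^bsub>L\<^esub> m"
    and P_mult_right: "\<lbrakk>e \<in> carrier E; f \<in> carrier E; f' \<in> carrier E\<rbrakk> \<Longrightarrow>
           P e (f \<otimes>\<^bsub>E\<^esub> f') =
             P e f \<otimes>\<^bsub>L\<^esub> group_peiffer_act L bd2 P (actE (bd1 e) f) (P e f')"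
    and P_mult_left: "\<lbrakk>e \<in> carrier E; f \<in> carrier E; f' \<in> carrier E\<rbrakk> \<Longrightarrow>
           P (e \<otimes>\<^bsub>E\<^esub> f) f' =
             P e (f \<otimes>\<^bsub>E\<^esub> f' \<otimes>\<^bsub>E\<^esub> inv\<^bsub>E\<^esub> f) \<otimes>\<^bsub>L\<^esub> actL (bd1 e) (P f f')"
    and P_bd2_left_right: "\<lbrakk>l \<in> carrier L; e \<in> carrier E\<rbrakk> \<Longrightarrow>
           P (bd2 l) e \<otimes>\<^bsub>L\<^esub> P e (bd2 l) = l \<otimes>\<^bsub>L\<^esub> actL (bd1 e) (inv\<^bsub>L\<^esub> l)"
    and peiffer_crossed: "group_crossed_module L E bd2 (group_peiffer_act L bd2 P)"

end

theory Submission
  imports Defs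
begin

text \<open>
  A group-like \<open>x\<close> has the coproduct \<open>x \<otimes> x\<close>, so every Sweedler sum over \<open>x\<close> collapses to the
  single term in which all of \<open>x', x'', \<dots>\<close> are \<open>x\<close>. The axioms of a 2-crossed module of Hopf
  algebras are identities between such sums; at group-like arguments, where the antipode is the
  inverse, they turn into the axioms for groups, word for word. This leaves two things to check.

  The first is that a Sweedler sum may be evaluated on the representative \<open>[(x, x)]\<close> of the
  coproduct instead of the list that the algebra happens to choose. This holds because the summand
  is bilinear over the field (\<open>sum_comult_Gl\<close>). For sums in which another Sweedler sum is nested,
  bilinearity of the summand in turn requires that the inner sum depends linearly on the element
  whose coproduct it runs over (\<open>sum_comult_add\<close>, \<open>sum_comult_smul\<close>).

  The second is that every operation sends group-likes to group-likes. All of them (products,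
  Hopf algebra maps, actions, the Peiffer lifting) are morphisms of coalgebras \<open>A \<otimes> B \<rightarrow> C\<close> or
  \<open>A \<rightarrow> C\<close>, and such morphisms preserve group-likes (\<open>Gl_linear_image\<close>, \<open>Gl_bilinear_image\<close>). The antipode is
  the exception: it is only known to be the convolution inverse of the identity, and \<open>antipode_Gl\<close>
  deduces from \<open>\<delta>(S(x)) \<delta>(x) = 1 \<otimes> 1\<close> that \<open>S(x)\<close> is group-like when \<open>x\<close> is.

  One axiom is not an identity between sums: the action \<open>k \<mapsto> k' {\<partial>\<^sub>2(S(k'')), x}\<close> of \<open>I\<close> on \<open>K\<close> gives
  a crossed module. The restriction to group-likes of a crossed module of Hopf algebras is one of
  groups by the same arguments, and the action agrees with its group counterpart at group-like \<open>k\<close>.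
\<close>

section \<open>Maps out of formal tensors\<close>

text \<open>
  The maps that factor through \<open>A \<otimes> A\<close>, which are the summands whose sum over a list depends only
  on the tensor. Moving a scalar between the two arguments is all that the tensor product demands,
  so the target is just an abelian group.
\<close>

definition balanced ::
  "('k \<Rightarrow> 'a \<Rightarrow> 'a) \<Rightarrow> ('a::ab_group_add \<Rightarrow> 'a \<Rightarrow> 'b::ab_group_add) \<Rightarrow> bool" where
  "balanced s f \<longleftrightarrow>
     (\<forall>a a' b. f (a + a') b = f a b + f a' b) \<and>
     (\<forall>a b b'. f a (b + b') = f a b + f a b') \<and>
     (\<forall>r a b. f (s r a) b = f a (s r b))"

lemma sum_list_tensor_eq:
  assumes "tensor2_eq s xs ys" and f: "balanced s f"
  shows "(\<Sum>(a, b)\<leftarrow>xs. f a b) = (\<Sum>(a, b)\<leftarrow>ys. f a b)"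
  using assms(1)
proof induction
  case (fsum_rel xs ys)
  have "f 0 b = 0" for b
    using f[unfolded balanced_def, THEN conjunct1, rule_format, of 0 0 b] by simp
  with fsum_rel f show ?case
    by (auto elim!: tensor2_rel.cases simp: balanced_def)
qed (auto simp: add.commute)

text \<open>
  The universal property of the quotient, for maps into another quotient of the same kind: \<open>F\<close>
  sends each pure tensor to a formal sum, and only the generating relations need to be respected.
\<close>

lemma fsum_eq_concat_map:
  assumes "fsum_eq R xs ys"
    and "\<And>xs ys. R xs ys \<Longrightarrow> fsum_eq R' (concat (map F xs)) (concat (map F ys))"
  shows "fsum_eq R' (concat (map F xs)) (concat (map F ys))"
  using assms(1)
  by induction (auto intro: assms(2) fsum_eq.intros)

lemma fsum_eq_map_Nil:
  assumes "\<And>p. fsum_eq R [h p] []"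
  shows "fsum_eq R (map h xs) []"
proof (induction xs)
  case (Cons p xs)
  then show ?case using fsum_append[OF assms Cons, of p] by simp
qed (simp add: fsum_refl)

lemma fsum_eq_map_cong:
  assumes "\<And>p. fsum_eq R [g p] [h p]"
  shows "fsum_eq R (map g xs) (map h xs)"
proof (induction xs)
  case (Cons p xs)
  then show ?case using fsum_append[OF assms Cons, of p] by simp
qed (simp add: fsum_refl)

text \<open>
  A termwise splitting interleaves the two families of summands; commutativity of formal sums
  gathers each of them.
\<close>

lemma fsum_eq_map_append:
  assumes "\<And>p. fsum_eq R [h p] [f p, g p]"
  shows "fsum_eq R (map h xs) (map f xs @ map g xs)"
proof (induction xs)
  case (Cons p xs)
  have "fsum_eq R (map h (p # xs)) ([f p] @ ([g p] @ map f xs) @ map g xs)"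
    using fsum_append[OF assms Cons, of p] by simp
  moreover have "fsum_eq R ([f p] @ ([g p] @ map f xs) @ map g xs)
                           ([f p] @ (map f xs @ [g p]) @ map g xs)"
    by (intro fsum_append fsum_refl fsum_comm)
  ultimately show ?case by (auto intro: fsum_trans)
qed (simp add: fsum_refl)

text \<open>
  A bilinear \<open>f\<close> induces a product \<open>(x \<otimes> x') (y \<otimes> y') = f x y \<otimes> f x' y'\<close> of tensors, and this is
  the half of its well-definedness that concerns \<open>x \<otimes> x'\<close>. The two tensor factors carry separate
  maps \<open>f\<close> and \<open>g\<close> for the sake of the other half: there, a fixed pair \<open>(x, x')\<close> leaves the two
  different linear maps \<open>f x\<close> and \<open>f x'\<close>.
\<close>

lemma tensor_eq_bilinear_left:
  fixes f g :: "'a::ab_group_add \<Rightarrow> 'b \<Rightarrow> 'c::ab_group_add"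
  assumes "tensor2_eq s X X'"
    and add: "\<And>a a' y. f (a + a') y = f a y + f a' y" "\<And>a a' y. g (a + a') y = g a y + g a' y"
    and scale: "\<And>r a y. f (s r a) y = s' r (f a y)" "\<And>r a y. g (s r a) y = s' r (g a y)"
  shows "tensor2_eq s' [(f x1 y1, g x2 y2). (x1, x2) \<leftarrow> X, (y1, y2) \<leftarrow> Y]
                       [(f x1 y1, g x2 y2). (x1, x2) \<leftarrow> X', (y1, y2) \<leftarrow> Y]"
  using assms(1)
proof (rule fsum_eq_concat_map)
  have zero: "f 0 y = 0" for y
    using add(1)[of 0 0 y] by simp
  note rel = fsum_rel[where R = "tensor2_rel s'"]
  fix xs ys :: "('a \<times> 'a) list"
  assume "tensor2_rel s xs ys"
  then show "tensor2_eq s'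
      (concat (map (\<lambda>(x1, x2). map (\<lambda>(y1, y2). (f x1 y1, g x2 y2)) Y) xs))
      (concat (map (\<lambda>(x1, x2). map (\<lambda>(y1, y2). (f x1 y1, g x2 y2)) Y) ys))"
  proof cases
    case (t2_zero b)
    then show ?thesis
      by (auto simp: zero intro!: fsum_eq_map_Nil rel[OF tensor2_rel.t2_zero])
  next
    case (t2_add1 a a' b)
    then show ?thesis
      by (auto simp: add intro!: fsum_eq_map_append rel[OF tensor2_rel.t2_add1])
  next
    case (t2_add2 a b b')
    then show ?thesis
      by (auto simp: add intro!: fsum_eq_map_append rel[OF tensor2_rel.t2_add2])
  next
    case (t2_scale r a b)
    then show ?thesis
      by (auto simp: scale intro!: fsum_eq_map_cong rel[OF tensor2_rel.t2_scale])
  qed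
qed

lemma tensor_eq_linear:
  assumes "tensor2_eq s X X'"
    and "\<And>a a'. f (a + a') = f a + f a'" "\<And>a a'. g (a + a') = g a + g a'"
    and "\<And>r a. f (s r a) = s' r (f a)" "\<And>r a. g (s r a) = s' r (g a)"
  shows "tensor2_eq s' [(f x1, g x2). (x1, x2) \<leftarrow> X] [(f x1, g x2). (x1, x2) \<leftarrow> X']"
proof -
  \<comment> \<open>A linear map is a bilinear one whose second argument is trivial.\<close>
  have *: "[(f x1, g x2). (x1, x2) \<leftarrow> Z] =
      [(f x1, g x2). (x1, x2) \<leftarrow> Z, (y1, y2) \<leftarrow> [((), ())]]" for Z
    by (induction Z) auto
  show ?thesis
    unfolding * using assms
    by (rule tensor_eq_bilinear_left[where f = "\<lambda>x _. f x" and g = "\<lambda>x _. g x"])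
qed

lemma tensor_eq_bilinear_right:
  assumes "tensor2_eq s Y Y'"
    and add: "\<And>x b b'. f x (b + b') = f x b + f x b'"
    and scale: "\<And>x r b. f x (s r b) = s' r (f x b)"
  shows "tensor2_eq s' [(f x1 y1, f x2 y2). (x1, x2) \<leftarrow> X, (y1, y2) \<leftarrow> Y]
                       [(f x1 y1, f x2 y2). (x1, x2) \<leftarrow> X, (y1, y2) \<leftarrow> Y']"
proof (induction X)
  case (Cons p X)
  obtain x1 x2 where p: "p = (x1, x2)" by fastforce
  have "tensor2_eq s' [(f x1 y1, f x2 y2). (y1, y2) \<leftarrow> Y] [(f x1 y1, f x2 y2). (y1, y2) \<leftarrow> Y']"
    using assms(1) add add scale scale by (rule tensor_eq_linear)
  from fsum_append[OF this Cons] show ?case by (simp add: p)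
qed (simp add: fsum_refl)


section \<open>The group of group-like elements\<close>

lemma Gl_iff:
  "x \<in> carrier (Gl A) \<longleftrightarrow> tensor2_eq (smul A) (comult A x) [(x, x)] \<and> counit A x = 1"
  by (simp add: Gl_def)

lemma Gl_mult [simp]: "x \<otimes>\<^bsub>Gl A\<^esub> y = x * y"
  and Gl_one [simp]: "\<one>\<^bsub>Gl A\<^esub> = 1"
  by (simp_all add: Gl_def)

lemma linear_add: "Vector_Spaces.linear s t f \<Longrightarrow> f (x + y) = f x + f y"
  and linear_scale: "Vector_Spaces.linear s t f \<Longrightarrow> f (s r x) = t r (f x)"
  by (auto dest!: Vector_Spaces.linear.axioms(3) simp: module_hom.add module_hom.scale)

lemma bilinear_overD:
  assumes "bilinear_over s1 s2 s3 f"
  shows "f (x + x') y = f x y + f x' y" "f x (y + y') = f x y + f x y'"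
    "f (s1 r x) y = s3 r (f x y)" "f x (s2 r y) = s3 r (f x y)"
  using assms unfolding bilinear_over_def
  by (auto dest: linear_add linear_scale)

lemma Gl_linear_image:
  assumes "Vector_Spaces.linear (smul A) (smul B) f"
    and "tensor2_eq (smul B) (comult B (f x)) [(f x1, f x2). (x1, x2) \<leftarrow> comult A x]"
    and "counit B (f x) = counit A x"
    and "x \<in> carrier (Gl A)"
  shows "f x \<in> carrier (Gl B)"
proof -
  have "tensor2_eq (smul B) [(f x1, f x2). (x1, x2) \<leftarrow> comult A x]
      [(f x1, f x2). (x1, x2) \<leftarrow> [(x, x)]]"
    using assms(4) by (intro tensor_eq_linear[where s = "smul A"])
      (auto simp: Gl_iff linear_add[OF assms(1)] linear_scale[OF assms(1)])
  with assms show ?thesis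
    by (auto simp: Gl_iff intro: fsum_trans)
qed

lemma Gl_bilinear_image:
  assumes f: "bilinear_over (smul A) (smul B) (smul C) f"
    and "tensor2_eq (smul C) (comult C (f x y))
      [(f x1 y1, f x2 y2). (x1, x2) \<leftarrow> comult A x, (y1, y2) \<leftarrow> comult B y]"
    and "counit C (f x y) = counit A x * counit B y"
    and x: "x \<in> carrier (Gl A)" and y: "y \<in> carrier (Gl B)"
  shows "f x y \<in> carrier (Gl C)"
proof -
  have "tensor2_eq (smul C)
      [(f x1 y1, f x2 y2). (x1, x2) \<leftarrow> comult A x, (y1, y2) \<leftarrow> comult B y]
      [(f x1 y1, f x2 y2). (x1, x2) \<leftarrow> [(x, x)], (y1, y2) \<leftarrow> comult B y]"
    using x by (intro tensor_eq_bilinear_left[where s = "smul A"])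
      (auto simp: Gl_iff bilinear_overD[OF f])
  moreover have "tensor2_eq (smul C)
      [(f x1 y1, f x2 y2). (x1, x2) \<leftarrow> [(x, x)], (y1, y2) \<leftarrow> comult B y]
      [(f x1 y1, f x2 y2). (x1, x2) \<leftarrow> [(x, x)], (y1, y2) \<leftarrow> [(y, y)]]"
    using y by (intro tensor_eq_bilinear_right[where s = "smul B"])
      (auto simp: Gl_iff bilinear_overD[OF f])
  ultimately have "tensor2_eq (smul C) (comult C (f x y)) [(f x y, f x y)]"
    using assms(2) by (auto intro: fsum_trans)
  with assms show ?thesis
    by (simp add: Gl_iff)
qed

context bialgebra
begin

lemma smul_add: "smul A r (x + y) = smul A r x + smul A r y"
  and smul_one: "smul A 1 x = x"
  and smul_zero: "smul A r 0 = 0"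
proof -
  interpret vector_space "smul A" by (rule vector_space)
  show "smul A r (x + y) = smul A r x + smul A r y" "smul A 1 x = x" "smul A r 0 = 0"
    by (simp_all add: scale_right_distrib)
qed

lemma smul_sum_list: "(\<Sum>p\<leftarrow>xs. smul A r (f p)) = smul A r (\<Sum>p\<leftarrow>xs. f p)"
  by (induction xs) (simp_all add: smul_add smul_zero)

lemma mult_bilinear: "bilinear_over (smul A) (smul A) (smul A) (*)"
  unfolding bilinear_over_def Vector_Spaces.linear_iff
  by (auto simp: vector_space distrib_left distrib_right
      smul_mult_left[symmetric] smul_mult_right[symmetric])

lemma mult_Gl: "x \<in> carrier (Gl A) \<Longrightarrow> y \<in> carrier (Gl A) \<Longrightarrow> x * y \<in> carrier (Gl A)"
  by (rule Gl_bilinear_image[OF mult_bilinear comult_mult counit_mult])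

lemma one_Gl: "1 \<in> carrier (Gl A)"
  by (simp add: Gl_iff comult_one counit_one)

lemma sum_comult_Gl:
  assumes "x \<in> carrier (Gl A)" and "balanced (smul A) f"
  shows "(\<Sum>(x1, x2)\<leftarrow>comult A x. f x1 x2) = f x x"
  using sum_list_tensor_eq[of "smul A" "comult A x" "[(x, x)]" f] assms
  by (simp add: Gl_iff)

text \<open>
  The Sweedler sum of a bilinear summand is linear in the element, as \<open>\<delta>\<close> is linear. The scalar is
  left on \<open>x'\<close>, from where the summand at hand can pull it out.
\<close>

lemma sum_comult_add:
  assumes "balanced (smul A) f"
  shows "(\<Sum>(x1, x2)\<leftarrow>comult A (x + y). f x1 x2) =
    (\<Sum>(x1, x2)\<leftarrow>comult A x. f x1 x2) + (\<Sum>(x1, x2)\<leftarrow>comult A y. f x1 x2)"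
  using sum_list_tensor_eq[OF comult_add assms, of x y] by simp

lemma sum_comult_smul:
  assumes "balanced (smul A) f"
  shows "(\<Sum>(x1, x2)\<leftarrow>comult A (smul A r x). f x1 x2) =
    (\<Sum>(x1, x2)\<leftarrow>comult A x. f (smul A r x1) x2)"
  using sum_list_tensor_eq[OF comult_smul assms, of r x] by (simp add: split_def o_def)

end

context cocomm_hopf_algebra
begin

lemmas antipode_add = linear_add[OF antipode_linear]
  and antipode_smul = linear_scale[OF antipode_linear]
lemmas smul_simps = smul_add smul_mult_left[symmetric] smul_mult_right[symmetric]
  antipode_add antipode_smul

lemma antipode_mult_Gl:
  assumes "x \<in> carrier (Gl A)"
  shows "antipode A x * x = 1" and "x * antipode A x = 1"
proof -
  have "balanced (smul A) (\<lambda>x1 x2. antipode A x1 * x2)"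
    and "balanced (smul A) (\<lambda>x1 x2. x1 * antipode A x2)"
    by (simp_all add: balanced_def smul_simps distrib_left distrib_right)
  from this[THEN sum_comult_Gl[OF assms]] assms
  show "antipode A x * x = 1" and "x * antipode A x = 1"
    by (simp_all add: antipode_left antipode_right Gl_iff smul_one)
qed

text \<open>
  Since \<open>x\<close> is group-like, \<open>1 \<otimes> 1 = \<delta>(S(x) x) = \<delta>(S(x)) (x \<otimes> x)\<close>. Multiplying on the right by
  \<open>S(x) \<otimes> S(x)\<close>, the inverse of \<open>x \<otimes> x\<close>, gives \<open>\<delta>(S(x)) = S(x) \<otimes> S(x)\<close>.
\<close>

lemma antipode_Gl:
  assumes x: "x \<in> carrier (Gl A)"
  shows "antipode A x \<in> carrier (Gl A)"
proof -
  let ?y = "antipode A x"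
  let ?Y = "comult A ?y"
  note inv = antipode_mult_Gl[OF x]
  have x2: "tensor2_eq (smul A) (comult A x) [(x, x)]"
    using x by (simp add: Gl_iff)
  have "tensor2_eq (smul A) [(y1 * x1, y2 * x2). (y1, y2) \<leftarrow> ?Y, (x1, x2) \<leftarrow> comult A x]
      [(y1 * x, y2 * x). (y1, y2) \<leftarrow> ?Y]"
    using tensor_eq_bilinear_right[OF x2, of "(*)" "smul A" ?Y]
    by (simp add: distrib_left smul_mult_right split_def)
  then have "tensor2_eq (smul A) [(1, 1)] [(y1 * x, y2 * x). (y1, y2) \<leftarrow> ?Y]"
    using comult_mult[of ?y x] comult_one unfolding inv
    by (blast intro: fsum_trans fsum_sym)
  then have "tensor2_eq (smul A) [(z1 * ?y, z2 * ?y). (z1, z2) \<leftarrow> [(1, 1)]]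
      [(z1 * ?y, z2 * ?y). (z1, z2) \<leftarrow> [(y1 * x, y2 * x). (y1, y2) \<leftarrow> ?Y]]"
    by (rule tensor_eq_linear) (simp_all add: distrib_right smul_mult_left)
  then have "tensor2_eq (smul A) ?Y [(?y, ?y)]"
    by (simp add: split_def o_def mult.assoc inv fsum_sym)
  moreover have "counit A ?y = 1"
    using counit_mult[of ?y x] x unfolding inv by (simp add: counit_one Gl_iff)
  ultimately show ?thesis by (simp add: Gl_iff)
qed

lemma group_Gl: "group (Gl A)"
proof (rule groupI)
  show "\<exists>y\<in>carrier (Gl A). y \<otimes>\<^bsub>Gl A\<^esub> x = \<one>\<^bsub>Gl A\<^esub>" if "x \<in> carrier (Gl A)" for x
    using that by (intro bexI[of _ "antipode A x"]) (simp_all add: antipode_mult_Gl antipode_Gl)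
qed (simp_all add: mult_Gl one_Gl mult.assoc)

lemma inv_Gl: "x \<in> carrier (Gl A) \<Longrightarrow> inv\<^bsub>Gl A\<^esub> x = antipode A x"
  by (rule group.inv_equality[OF group_Gl]) (simp_all add: antipode_mult_Gl antipode_Gl)

lemma adj_Gl: "x \<in> carrier (Gl A) \<Longrightarrow> adj A x y = x * y * antipode A x"
  unfolding adj_def
  by (rule sum_comult_Gl) (simp_all add: balanced_def smul_simps distrib_left distrib_right)

lemma adj_add_left: "adj A (x + x') y = adj A x y + adj A x' y"
  unfolding adj_def
  by (rule sum_comult_add) (simp_all add: balanced_def smul_simps distrib_left distrib_right)

lemma adj_smul_left: "adj A (smul A r x) y = smul A r (adj A x y)"
proof -
  have "balanced (smul A) (\<lambda>x1 x2. x1 * y * antipode A x2)"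
    by (simp add: balanced_def smul_simps distrib_left distrib_right)
  from sum_comult_smul[OF this] show ?thesis
    by (simp add: adj_def split_def smul_sum_list smul_simps)
qed

lemma adj_add_right: "adj A x (y + y') = adj A x y + adj A x y'"
  by (simp add: adj_def split_def distrib_left distrib_right sum_list_addf)

lemma adj_smul_right: "adj A x (smul A r y) = smul A r (adj A x y)"
  by (simp add: adj_def split_def smul_sum_list smul_simps)

lemmas adj_simps = adj_add_left adj_smul_left adj_add_right adj_smul_right

end

section \<open>Homomorphisms and actions on group-likes\<close>

lemma (in hopf_hom) hom_Gl: "x \<in> carrier (Gl A) \<Longrightarrow> f x \<in> carrier (Gl B)"
  by (rule Gl_linear_image[OF hom_linear hom_comult hom_counit])

lemma (in hopf_hom) Gl_hom: "f \<in> hom (Gl A) (Gl B)"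
  by (auto simp: hom_def hom_Gl hom_mult)

lemma (in module_bialgebra) act_Gl:
  "a \<in> carrier (Gl H) \<Longrightarrow> x \<in> carrier (Gl I) \<Longrightarrow> act a x \<in> carrier (Gl I)"
  by (rule Gl_bilinear_image[OF act_bilinear act_comult act_counit])

lemma (in module_bialgebra) act_mult_Gl:
  assumes "a \<in> carrier (Gl H)"
  shows "act a (u * v) = act a u * act a v"
  unfolding act_mult
  using assms by (rule H.sum_comult_Gl)
    (simp add: balanced_def bilinear_overD[OF act_bilinear] distrib_left distrib_right
      I.smul_mult_left[symmetric] I.smul_mult_right[symmetric])

text \<open>
  A group-like \<open>a\<close> acts multiplicatively, and invertibly because \<open>S(a)\<close> acts as the inverse.
\<close>

lemma group_act_autos_Gl:
  assumes "cocomm_hopf_algebra H" and "cocomm_hopf_algebra I" and "module_bialgebra H I act"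
  shows "group_act_autos (Gl H) (Gl I) act"
proof -
  interpret H: cocomm_hopf_algebra H by fact
  interpret I: cocomm_hopf_algebra I by fact
  interpret module_bialgebra H I act by fact
  have inverse: "act a (act b x) = x" if "a * b = 1" for a b x
    using that mult_act[of a b x] one_act[of x] by simp
  show ?thesis
  proof (intro group_act_autos.intro group_act_autos_axioms.intro H.group_Gl I.group_Gl)
    fix a assume a: "a \<in> carrier (Gl H)"
    have "bij_betw (act a) (carrier (Gl I)) (carrier (Gl I))"
      using a by (intro bij_betw_byWitness[where f' = "act (antipode H a)"])
        (auto simp: inverse H.antipode_mult_Gl act_Gl H.antipode_Gl)
    with a show "act a \<in> iso (Gl I) (Gl I)"
      by (auto simp: iso_def hom_def act_Gl act_mult_Gl)
  qed (simp_all add: one_act mult_act)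
qed

lemma group_crossed_module_Gl:
  assumes "hopf_crossed_module I H bd act"
  shows "group_crossed_module (Gl I) (Gl H) bd act"
proof -
  interpret hopf_crossed_module I H bd act by fact
  show ?thesis
    by (intro group_crossed_module.intro group_crossed_module_axioms.intro group_act_autos_Gl)
      (unfold_locales, simp_all add: Gl_hom bd_act peiffer H.adj_Gl I.adj_Gl
        H.inv_Gl I.inv_Gl hom_Gl)
qed

text \<open>
  The two Peiffer actions, by Sweedler sums and by group inverses, are functions on all of the
  algebra that are only known to agree at group-likes.
\<close>

lemma group_crossed_module_cong:
  assumes "group_crossed_module E G bd act"
    and eq: "\<And>g e. g \<in> carrier G \<Longrightarrow> e \<in> carrier E \<Longrightarrow> act' g e = act g e"
  shows "group_crossed_module E G bd act'"
proof -
  interpret group_crossed_module E G bd act by fact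
  have closed: "act g e \<in> carrier E" if "g \<in> carrier G" "e \<in> carrier E" for g e
    using act_iso[OF that(1)] that(2) by (auto simp: iso_def hom_def)
  have "act' g \<in> iso E E" if "g \<in> carrier G" for g
    using act_iso[OF that] that bij_betw_cong[of "carrier E" "act' g" "act g"]
    by (auto simp: iso_def hom_def eq)
  moreover have "bd e \<in> carrier G" if "e \<in> carrier E" for e
    using bd_hom that by (auto simp: hom_def)
  ultimately show ?thesis
    by unfold_locales (simp_all add: eq closed one_act mult_act bd_hom bd_act peiffer)
qed


section \<open>The Peiffer lifting on group-likes\<close>

context hopf_2_crossed_module
begin

lemma P_Gl: "x \<in> carrier (Gl I) \<Longrightarrow> y \<in> carrier (Gl I) \<Longrightarrow> P x y \<in> carrier (Gl K)"
  by (rule Gl_bilinear_image[OF P_bilinear P_comult P_counit])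

text \<open>
  Linearity of every operation, directed so that sums and scalars move outwards. The action of \<open>I\<close>
  on \<open>K\<close> built from the Peiffer lifting is bilinear because it is part of a crossed module.
\<close>

lemmas lin_simps =
  bilinear_overD[OF P_bilinear] bilinear_overD[OF actI.act_bilinear]
  bilinear_overD[OF actK.act_bilinear]
  bilinear_overD[OF hopf_crossed_module.axioms(4)[OF peiffer_crossed,
    THEN module_bialgebra.act_bilinear]]
  linear_add[OF bd1.hom_linear] linear_scale[OF bd1.hom_linear]
  linear_add[OF bd2.hom_linear] linear_scale[OF bd2.hom_linear]
  K.smul_simps I.smul_simps H.smul_simps I.adj_simps K.adj_simps
  K.smul_sum_list I.smul_sum_list H.smul_sum_list
  distrib_left distrib_right sum_list_addf split_def

lemma peiffer_act_Gl:
  assumes "k \<in> carrier (Gl K)"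
  shows "peiffer_act K bd2 P x k = group_peiffer_act (Gl K) bd2 P x k"
proof -
  have "peiffer_act K bd2 P x k = k * P (bd2 (antipode K k)) x"
    unfolding peiffer_act_def using assms
    by (rule K.sum_comult_Gl) (simp add: balanced_def lin_simps)
  with assms show ?thesis
    by (simp add: group_peiffer_act_def K.inv_Gl)
qed

lemma bd2_P_Gl:
  assumes x: "x \<in> carrier (Gl I)" and y: "y \<in> carrier (Gl I)"
  shows "bd2 (P x y) = x * y * antipode I x * actI (bd1 x) (antipode I y)"
proof -
  have "bd2 (P x y) =
      (\<Sum>(y1, y2)\<leftarrow>comult I y. adj I x y1 * actI (bd1 x) (antipode I y2))"
    unfolding bd2_P using x
    by (rule I.sum_comult_Gl) (simp add: balanced_def lin_simps)
  also have "\<dots> = adj I x y * actI (bd1 x) (antipode I y)"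
    using y by (rule I.sum_comult_Gl) (simp add: balanced_def lin_simps)
  finally show ?thesis
    using x by (simp add: I.adj_Gl)
qed

lemma P_bd2_bd2_Gl:
  assumes k: "k \<in> carrier (Gl K)" and l: "l \<in> carrier (Gl K)"
  shows "P (bd2 k) (bd2 l) = k * l * antipode K k * antipode K l"
proof -
  have "P (bd2 k) (bd2 l) = adj K k l * antipode K l"
    unfolding P_bd2_bd2 using l
    by (rule K.sum_comult_Gl) (simp add: balanced_def lin_simps)
  with k show ?thesis
    by (simp add: K.adj_Gl)
qed

lemma P_mult_right_Gl:
  assumes x: "x \<in> carrier (Gl I)" and y: "y \<in> carrier (Gl I)"
  shows "P x (y * z) = P x y * peiffer_act K bd2 P (actI (bd1 x) y) (P x z)"
proof -
  \<comment> \<open>The coproduct of \<open>x\<close> is iterated here: the inner sum runs over the coproduct of \<open>r\<close>, so its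
    linearity in \<open>r\<close> is needed before the outer sum collapses.\<close>
  define g where "g x1 x2 x3 =
    (\<Sum>(y1, y2)\<leftarrow>comult I y. P x1 y1 * peiffer_act K bd2 P (actI (bd1 x2) y2) (P x3 z))"
    for x1 x2 x3
  have g: "balanced (smul I) (g x1)" for x1
    by (simp add: g_def balanced_def lin_simps)
  have "P x (y * z) = (\<Sum>(x1, r)\<leftarrow>comult I x. \<Sum>(x2, x3)\<leftarrow>comult I r. g x1 x2 x3)"
    by (simp add: P_mult_right g_def)
  also have "\<dots> = (\<Sum>(x2, x3)\<leftarrow>comult I x. g x x2 x3)"
    using x
  proof (rule I.sum_comult_Gl)
    show "balanced (smul I) (\<lambda>x1 r. \<Sum>(x2, x3)\<leftarrow>comult I r. g x1 x2 x3)"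
      unfolding balanced_def I.sum_comult_add[OF g] I.sum_comult_smul[OF g]
      by (simp add: g_def lin_simps)
  qed
  also have "\<dots> = g x x x"
    using x g by (rule I.sum_comult_Gl)
  also have "\<dots> = P x y * peiffer_act K bd2 P (actI (bd1 x) y) (P x z)"
    unfolding g_def using y
    by (rule I.sum_comult_Gl) (simp add: balanced_def lin_simps)
  finally show ?thesis .
qed

lemma P_mult_left_Gl:
  assumes x: "x \<in> carrier (Gl I)" and y: "y \<in> carrier (Gl I)" and z: "z \<in> carrier (Gl I)"
  shows "P (x * y) z = P x (y * z * antipode I y) * actK (bd1 x) (P y z)"
proof -
  have "P (x * y) z = (\<Sum>(y1, y2)\<leftarrow>comult I y. \<Sum>(z1, z2)\<leftarrow>comult I z.
      P x (adj I y1 z1) * actK (bd1 x) (P y2 z2))"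
    unfolding P_mult_left using x
    by (rule I.sum_comult_Gl) (simp add: balanced_def lin_simps)
  also have "\<dots> = (\<Sum>(z1, z2)\<leftarrow>comult I z. P x (adj I y z1) * actK (bd1 x) (P y z2))"
    using y by (rule I.sum_comult_Gl) (simp add: balanced_def lin_simps)
  also have "\<dots> = P x (adj I y z) * actK (bd1 x) (P y z)"
    using z by (rule I.sum_comult_Gl) (simp add: balanced_def lin_simps)
  finally show ?thesis
    using y by (simp add: I.adj_Gl)
qed

lemma P_bd2_left_right_Gl:
  assumes k: "k \<in> carrier (Gl K)" and x: "x \<in> carrier (Gl I)"
  shows "P (bd2 k) x * P x (bd2 k) = k * actK (bd1 x) (antipode K k)"
proof -
  have "P (bd2 k) x * P x (bd2 k) =
      (\<Sum>(x1, x2)\<leftarrow>comult I x. P (bd2 k) x1 * P x2 (bd2 k))"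
    using x by (rule I.sum_comult_Gl[symmetric]) (simp add: balanced_def lin_simps)
  also have "\<dots> = (\<Sum>(k1, k2)\<leftarrow>comult K k. \<Sum>(x1, x2)\<leftarrow>comult I x.
      P (bd2 k1) x1 * P x2 (bd2 k2))"
    using k by (rule K.sum_comult_Gl[symmetric]) (simp add: balanced_def lin_simps)
  also have "\<dots> = k * actK (bd1 x) (antipode K k)"
    unfolding P_bd2_left_right using k
    by (rule K.sum_comult_Gl) (simp add: balanced_def lin_simps)
  finally show ?thesis .
qed

lemma P_equivariant_Gl:
  assumes "a \<in> carrier (Gl H)"
  shows "actK a (P x y) = P (actI a x) (actI a y)"
  unfolding P_equivariant using assms
  by (rule H.sum_comult_Gl) (simp add: balanced_def lin_simps)

end

theorem theorem6p11:
  fixes K :: "('k::field, 'c::ring_1) hopf"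
    and I :: "('k, 'i::ring_1) hopf"
    and H :: "('k, 'h::ring_1) hopf"
    and bd2 :: "'c \<Rightarrow> 'i"
    and bd1 :: "'i \<Rightarrow> 'h"
    and actI :: "'h \<Rightarrow> 'i \<Rightarrow> 'i"
    and actK :: "'h \<Rightarrow> 'c \<Rightarrow> 'c"
    and P :: "'i \<Rightarrow> 'i \<Rightarrow> 'c"
  assumes "hopf_2_crossed_module K I H bd2 bd1 actI actK P"
  shows "group_2_crossed_module (Gl K) (Gl I) (Gl H) bd2 bd1 actI actK P"
proof -
  interpret hopf_2_crossed_module K I H bd2 bd1 actI actK P by fact
  have actI: "group_act_autos (Gl H) (Gl I) actI"
    and actK: "group_act_autos (Gl H) (Gl K) actK"
    by (rule group_act_autos_Gl; unfold_locales)+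
  have crossed: "group_crossed_module (Gl K) (Gl I) bd2 (group_peiffer_act (Gl K) bd2 P)"
    by (rule group_crossed_module_cong[OF group_crossed_module_Gl[OF peiffer_crossed]])
      (simp add: peiffer_act_Gl)
  show ?thesis
  proof (intro group_2_crossed_module.intro group_2_crossed_module_axioms.intro actI actK crossed)
    fix k assume "k \<in> carrier (Gl K)"
    then show "bd1 (bd2 k) = \<one>\<^bsub>Gl H\<^esub>"
      by (simp add: complex Gl_iff H.smul_one)
  next
    fix x y z assume x: "x \<in> carrier (Gl I)" and y: "y \<in> carrier (Gl I)"
      and z: "z \<in> carrier (Gl I)"
    show "P x (y \<otimes>\<^bsub>Gl I\<^esub> z) =
        P x y \<otimes>\<^bsub>Gl K\<^esub> group_peiffer_act (Gl K) bd2 P (actI (bd1 x) y) (P x z)"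
      using P_mult_right_Gl[OF x y, of z] peiffer_act_Gl[OF P_Gl[OF x z]] by simp
  qed (simp_all add: bd1.Gl_hom bd2.Gl_hom P_Gl P_equivariant_Gl bd2_act bd1_act bd2_P_Gl
      P_bd2_bd2_Gl P_mult_left_Gl P_bd2_left_right_Gl H.adj_Gl H.inv_Gl I.inv_Gl K.inv_Gl mult.assoc)
qed

end
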